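(* Let $\widehat\nabla = d-\sum_{i\in I^0}\widehat H_i\,dt_i$ be the universal simply-laced quantum connection of the star with Harnad-dual reading, and $\widehat\nabla' = d-\sum_{i\in I^0}\widehat H'_i\,dt_i$ the connection encoding the image $\widehat\mu^*(\widehat H^{\mathrm{DMT}}_i)$ of the DMT Hamiltonians, both on the trivial bundle $\widehat A\times\mathbf{B}\to\mathbf{B}$. Then the $\widehat A$-valued one-form $\widehat\nabla-\widehat\nabla'$ on $\mathbf{B}$ vanishes in the semiclassical limit, i.e. at every point of $\mathbf{B}$ each of its components $\langle\widehat\nabla-\widehat\nabla',\partial_{t_i}\rangle$ lies in the kernel of $\sigma\colon\widehat A\to A_0$.
   Context: Everything is over $\mathbb{C}$. Let $I^0$ be a finite set, $V_i$ ($i\in I^0$) one-dimensional vector spaces, $W^0=\bigoplus_{i\in I^0}V_i$, $W^\infty$ a finite-dimensional vector space. Let $\mathbb{M}=\mathrm{Hom}(W^0,W^\infty)\oplus\mathrm{Hom}(W^\infty,W^0)$ with points $(P,Q)$, $Q\colon W^\infty\to W^0$, $P\colon W^0\to W^\infty$, components $Q_i\colon W^\infty\to V_i$ (row vectors) and $P_i\colon V_i\to W^\infty$ (column vectors), symplectic form $\mathrm{Tr}(dQ\wedge dP)$, and Poisson bracket on $A_0=\mathrm{Sym}(\mathbb{M}^* )$ with $\{(Q_i)_k,(P_j)_l\}=\delta_{ij}\delta_{kl}$, all other brackets of coordinates vanishing. $\mathbf{B}=\mathbb{C}^{I^0}\setminus\{\text{diagonals}\}$ with coordinates $t_i$. $A$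 is the Weyl algebra, i.e. the quotient of the tensor algebra of $\mathbb{M}^*$ by the two-sided ideal generated by $f\otimes g-g\otimes f-\{f,g\}$ ($f,g\in\mathbb{M}^*$), filtered by $A_{\le k}$ induced from tensor degree; $\mathrm{gr}(A)\simeq A_0$ canonically, and $\sigma_k\colon A_{\le k}\to(A_0)_k$ is the degree-$k$ symbol map. For $f\in A$ let $|f|=\min\{k:f\in A_{\le k}\}$; $\widehat A=\{\sum_kf_k\hslash^k : f_k\in A_{\le k},\ \lim_k(k-|f_k|)=+\infty\}\subseteq A[[\hslash]]$. The semiclassical limit is $\sigma\colon\widehat A\to A_0$, $\sigma(\sum_kf_k\hslash^k)=\sum_k\sigma_k(f_k)$. $\widehat Q_i,\widehat P_i$ are the matrices whose entries are the images in $A$ of the coordinate functions $(Q_i)_k,(P_i)_k$; traces of products are taken in the written order. The universal simply-laced quantum Hamiltonians are $$\widehat H_i=\sum_{j\in I^0\setminus\{i\}}\frac{\mathrm{Tr}(\widehat P_j\widehat Q_j\widehat P_i\widehat Q_i)}{t_i-t_j}\,\hslash^4.$$ With the quantum comoment map $\widehat\mu^*\colon U(\mathfrak{gl}(W^0)^* )\to A$, $\widehat\mu^*(\widehat R_{ij})=\sum_k(\widehat Q_i)_k(\widehat P_j)_k$, and the DMT (De Concini, Millson--Toledano Laredo) Hamiltonians in the form $\widehat H^{\mathrm{DMT}}_i=\sum_{j\ne i}\widehat R_{ij}\widehat R_{ji}/(t_i-t_j)$, one has $\widehat\mu^*(\widehat H_i^{\mathrm{DMT}})=\sum_{j\neq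 i}\mathrm{Tr}(\widehat Q_i\widehat P_j\widehat Q_j\widehat P_i)/(t_i-t_j)$, and $\widehat H'_i$ is its $\hslash$-deformed version $$\widehat H'_i=\sum_{j\in I^0\setminus\{i\}}\frac{\mathrm{Tr}(\widehat Q_i\widehat P_j\widehat Q_j\widehat P_i)}{t_i-t_j}\,\hslash^4.$$ *)

theory Defs
  imports Complex_Main "HOL-Library.Poly_Mapping" "HOL-Algebra.QuotRing"
begin

section \<open>Coordinates on the symplectic space and the tensor algebra\<close>

text \<open>
  Bases of the lines \<open>V\<^sub>i\<close> (\<open>i \<in> I\<close>, with \<open>I\<close> the finite set of nodes other than the
  centre of the star) and of \<open>W\<^sup>\<infinity>\<close> (of arbitrary dimension \<open>n\<close>, possibly zero) are fixed.
  \<open>Qc i k\<close> and \<open>Pc i k\<close> with \<open>i \<in> I\<close>, \<open>k < n\<close> name the coordinate functions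
  \<open>(Q\<^sub>i)\<^sub>k\<close> and \<open>(P\<^sub>i)\<^sub>k\<close>, which form a basis of the dual of the symplectic space.
\<close>

datatype 'i coord = Qc 'i nat | Pc 'i nat

definition coords :: "'i set \<Rightarrow> nat \<Rightarrow> 'i coord set" where
  "coords I n = {Qc i k | i k. i \<in> I \<and> k < n} \<union> {Pc i k | i k. i \<in> I \<and> k < n}"

text \<open>
  Words under concatenation, written additively because the convolution product of
  finitely supported functions is indexed by an additive monoid.  Thus
  \<open>'x word \<Rightarrow>\<^sub>0 complex\<close> is the free associative algebra on \<open>'x\<close>, that is, the tensor algebra
  of the vector space with basis \<open>'x\<close>; the tensor product is \<open>(*)\<close>.
\<close>

datatype 'x word = Word (letters: "'x list")

instantiation word :: (type) monoid_add
begin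

definition "0 = Word []"

definition "v + w = Word (letters v @ letters w)"

instance
  by standard (simp_all add: zero_word_def plus_word_def)

end

type_synonym 'i tensor = "'i coord word \<Rightarrow>\<^sub>0 complex"

abbreviation const :: "complex \<Rightarrow> 'i tensor" where
  "const c \<equiv> Poly_Mapping.single 0 c"

abbreviation letter :: "'i coord \<Rightarrow> 'i tensor" where
  "letter x \<equiv> Poly_Mapping.single (Word [x]) 1"

definition tensor_alg :: "'i set \<Rightarrow> nat \<Rightarrow> 'i tensor ring" where
  "tensor_alg I n =
    \<lparr>carrier = {p. \<forall>w \<in> Poly_Mapping.keys p. set (letters w) \<subseteq> coords I n},
     mult = (*), one = 1, zero = 0, add = (+)\<rparr>"

definition tensor_le :: "'i set \<Rightarrow> nat \<Rightarrow> nat \<Rightarrow> 'i tensor set" where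
  "tensor_le I n k =
    {p \<in> carrier (tensor_alg I n). \<forall>w \<in> Poly_Mapping.keys p. length (letters w) \<le> k}"

definition linear_forms :: "'i set \<Rightarrow> nat \<Rightarrow> 'i tensor set" where
  "linear_forms I n =
    {p \<in> carrier (tensor_alg I n). \<forall>w \<in> Poly_Mapping.keys p. length (letters w) = 1}"

section \<open>The Weyl algebra\<close>

fun coord_bracket :: "'i coord \<Rightarrow> 'i coord \<Rightarrow> complex" where
  "coord_bracket (Qc i k) (Pc j l) = (if i = j \<and> k = l then 1 else 0)"
| "coord_bracket (Pc i k) (Qc j l) = (if i = j \<and> k = l then - 1 else 0)"
| "coord_bracket (Qc i k) (Qc j l) = 0"
| "coord_bracket (Pc i k) (Pc j l) = 0"

text \<open>
  The Poisson bracket of two linear forms is a constant; no other brackets are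
  needed to present the Weyl algebra.
\<close>

definition poisson :: "'i set \<Rightarrow> nat \<Rightarrow> 'i tensor \<Rightarrow> 'i tensor \<Rightarrow> complex" where
  "poisson I n f g =
    (\<Sum>x \<in> coords I n. \<Sum>y \<in> coords I n.
      Poly_Mapping.lookup f (Word [x]) * Poly_Mapping.lookup g (Word [y]) * coord_bracket x y)"

definition weyl_ideal :: "'i set \<Rightarrow> nat \<Rightarrow> 'i tensor set" where
  "weyl_ideal I n =
    genideal (tensor_alg I n)
      {f * g - g * f - const (poisson I n f g) | f g. f \<in> linear_forms I n \<and> g \<in> linear_forms I n}"

type_synonym 'i weyl_elt = "'i tensor set"

definition weyl :: "'i set \<Rightarrow> nat \<Rightarrow> 'i weyl_elt ring" where
  "weyl I n = tensor_alg I n Quot weyl_ideal I n"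

definition weyl_class :: "'i set \<Rightarrow> nat \<Rightarrow> 'i tensor \<Rightarrow> 'i weyl_elt" where
  "weyl_class I n p = weyl_ideal I n +>\<^bsub>tensor_alg I n\<^esub> p"

definition weyl_scale :: "'i set \<Rightarrow> nat \<Rightarrow> complex \<Rightarrow> 'i weyl_elt \<Rightarrow> 'i weyl_elt" where
  "weyl_scale I n c a = weyl_class I n (const c) \<otimes>\<^bsub>weyl I n\<^esub> a"

definition weyl_le :: "'i set \<Rightarrow> nat \<Rightarrow> nat \<Rightarrow> 'i weyl_elt set" where
  "weyl_le I n k = weyl_class I n ` tensor_le I n k"

definition weyl_order :: "'i set \<Rightarrow> nat \<Rightarrow> 'i weyl_elt \<Rightarrow> nat" where
  "weyl_order I n a = (LEAST k. a \<in> weyl_le I n k)"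

section \<open>Symbols\<close>

text \<open>
  The symmetric algebra on the coordinates, as polynomials: finitely supported functions
  on exponent vectors.
\<close>

type_synonym 'i sym = "('i coord \<Rightarrow>\<^sub>0 nat) \<Rightarrow>\<^sub>0 complex"

definition exponents :: "'x word \<Rightarrow> 'x \<Rightarrow>\<^sub>0 nat" where
  "exponents w = (\<Sum>x\<leftarrow>letters w. Poly_Mapping.single x 1)"

text \<open>
  The image in the symmetric algebra of the degree-\<open>k\<close> homogeneous component of a tensor.
\<close>

definition sym_part :: "nat \<Rightarrow> 'i tensor \<Rightarrow> 'i sym" where
  "sym_part k p =
    (\<Sum>w | w \<in> Poly_Mapping.keys p \<and> length (letters w) = k.
      Poly_Mapping.single (exponents w) (Poly_Mapping.lookup p w))"

text \<open>
  The degree-\<open>k\<close> symbol of an element \<open>a\<close> of filtration degree at most \<open>k\<close>: its class in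
  the \<open>k\<close>-th graded piece, read in the symmetric algebra.  That the result does not depend
  on the lift \<open>p\<close> of \<open>a\<close> is the Poincare-Birkhoff-Witt theorem for the Weyl algebra.
\<close>

definition symbol :: "'i set \<Rightarrow> nat \<Rightarrow> nat \<Rightarrow> 'i weyl_elt \<Rightarrow> 'i sym" where
  "symbol I n k a = (THE s. \<exists>p \<in> tensor_le I n k. a = weyl_class I n p \<and> s = sym_part k p)"

section \<open>Formal deformation and semiclassical limit\<close>

text \<open>Formal power series in \<open>\<hbar>\<close> over the Weyl algebra, given by their coefficients.\<close>

type_synonym 'i weyl_series = "nat \<Rightarrow> 'i weyl_elt"

definition hbar_monom :: "'i set \<Rightarrow> nat \<Rightarrow> 'i weyl_elt \<Rightarrow> nat \<Rightarrow> 'i weyl_series" where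
  "hbar_monom I n a m = (\<lambda>k. if k = m then a else \<zero>\<^bsub>weyl I n\<^esub>)"

definition series_diff :: "'i set \<Rightarrow> nat \<Rightarrow> 'i weyl_series \<Rightarrow> 'i weyl_series \<Rightarrow> 'i weyl_series" where
  "series_diff I n f g = (\<lambda>k. f k \<ominus>\<^bsub>weyl I n\<^esub> g k)"

definition weyl_hat :: "'i set \<Rightarrow> nat \<Rightarrow> 'i weyl_series set" where
  "weyl_hat I n =
    {f. (\<forall>k. f k \<in> weyl_le I n k) \<and>
        filterlim (\<lambda>k. int k - int (weyl_order I n (f k))) at_top sequentially}"

text \<open>
  On \<open>weyl_hat I n\<close> only finitely many symbols are nonzero, because \<open>symbol I n k a = 0\<close>
  as soon as \<open>k\<close> exceeds the order of \<open>a\<close>.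
\<close>

definition semiclassical :: "'i set \<Rightarrow> nat \<Rightarrow> 'i weyl_series \<Rightarrow> 'i sym" where
  "semiclassical I n f = (\<Sum>k | symbol I n k (f k) \<noteq> 0. symbol I n k (f k))"

definition semiclassical_kernel :: "'i set \<Rightarrow> nat \<Rightarrow> 'i weyl_series set" where
  "semiclassical_kernel I n = {f \<in> weyl_hat I n. semiclassical I n f = 0}"

section \<open>Matrices and Hamiltonians\<close>

text \<open>
  Matrices with noncommuting entries.  The index set of \<open>W\<^sup>\<infinity>\<close> is \<open>{..<n}\<close>, that of each line
  \<open>V\<^sub>i\<close> is \<open>UNIV :: unit set\<close>.
\<close>

definition mat_mul ::
    "('a, 'm) ring_scheme \<Rightarrow> 'k set \<Rightarrow> ('r \<Rightarrow> 'k \<Rightarrow> 'a) \<Rightarrow> ('k \<Rightarrow> 'c \<Rightarrow> 'a) \<Rightarrow> 'r \<Rightarrow> 'c \<Rightarrow> 'a" where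
  "mat_mul R K M N = (\<lambda>r c. \<Oplus>\<^bsub>R\<^esub>k\<in>K. M r k \<otimes>\<^bsub>R\<^esub> N k c)"

definition mat_trace :: "('a, 'm) ring_scheme \<Rightarrow> 'k set \<Rightarrow> ('k \<Rightarrow> 'k \<Rightarrow> 'a) \<Rightarrow> 'a" where
  "mat_trace R K M = (\<Oplus>\<^bsub>R\<^esub>k\<in>K. M k k)"

definition Qhat :: "'i set \<Rightarrow> nat \<Rightarrow> 'i \<Rightarrow> unit \<Rightarrow> nat \<Rightarrow> 'i weyl_elt" where
  "Qhat I n i = (\<lambda>_ k. weyl_class I n (letter (Qc i k)))"

definition Phat :: "'i set \<Rightarrow> nat \<Rightarrow> 'i \<Rightarrow> nat \<Rightarrow> unit \<Rightarrow> 'i weyl_elt" where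
  "Phat I n i = (\<lambda>k _. weyl_class I n (letter (Pc i k)))"

definition trace_PQPQ :: "'i set \<Rightarrow> nat \<Rightarrow> 'i \<Rightarrow> 'i \<Rightarrow> 'i weyl_elt" where
  "trace_PQPQ I n j i =
    (let A = weyl I n; V = (UNIV :: unit set); W = {..<n} in
      mat_trace A W
        (mat_mul A V (mat_mul A W (mat_mul A V (Phat I n j) (Qhat I n j)) (Phat I n i)) (Qhat I n i)))"

definition trace_QPQP :: "'i set \<Rightarrow> nat \<Rightarrow> 'i \<Rightarrow> 'i \<Rightarrow> 'i weyl_elt" where
  "trace_QPQP I n i j =
    (let A = weyl I n; V = (UNIV :: unit set); W = {..<n} in
      mat_trace A V
        (mat_mul A W (mat_mul A V (mat_mul A W (Qhat I n i) (Phat I n j)) (Qhat I n j)) (Phat I n i)))"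

definition base_space :: "'i set \<Rightarrow> ('i \<Rightarrow> complex) set" where
  "base_space I = {t. inj_on t I}"

definition slqc_ham :: "'i set \<Rightarrow> nat \<Rightarrow> 'i \<Rightarrow> ('i \<Rightarrow> complex) \<Rightarrow> 'i weyl_series" where
  "slqc_ham I n i t =
    hbar_monom I n (\<Oplus>\<^bsub>weyl I n\<^esub>j\<in>I - {i}. weyl_scale I n (1 / (t i - t j)) (trace_PQPQ I n j i)) 4"

text \<open>
  The \<open>\<hbar>\<close>-deformation of the image of the DMT Hamiltonian
  \<open>\<Sum>\<^sub>j R\<^sub>i\<^sub>j R\<^sub>j\<^sub>i / (t\<^sub>i - t\<^sub>j)\<close> under the quantum comoment map
  \<open>R\<^sub>i\<^sub>j \<mapsto> \<Sum>\<^sub>k (Q\<^sub>i)\<^sub>k (P\<^sub>j)\<^sub>k\<close>.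
\<close>

definition dmt_ham :: "'i set \<Rightarrow> nat \<Rightarrow> 'i \<Rightarrow> ('i \<Rightarrow> complex) \<Rightarrow> 'i weyl_series" where
  "dmt_ham I n i t =
    hbar_monom I n (\<Oplus>\<^bsub>weyl I n\<^esub>j\<in>I - {i}. weyl_scale I n (1 / (t i - t j)) (trace_QPQP I n i j)) 4"

section \<open>Connections on the trivial bundle\<close>

text \<open>
  A one-form on the base with values in series takes a base point and a tangent vector
  (a vector of the ambient coordinate space).
\<close>

type_synonym 'i one_form = "('i \<Rightarrow> complex) \<Rightarrow> ('i \<Rightarrow> complex) \<Rightarrow> 'i weyl_series"

text \<open>The one-form \<open>\<Sum>\<^sub>i H\<^sub>i dt\<^sub>i\<close>, where \<open>dt\<^sub>i\<close> evaluates on \<open>v\<close> to \<open>v i\<close>.\<close>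

definition ham_form ::
    "'i set \<Rightarrow> nat \<Rightarrow> ('i \<Rightarrow> ('i \<Rightarrow> complex) \<Rightarrow> 'i weyl_series) \<Rightarrow> 'i one_form" where
  "ham_form I n H = (\<lambda>t v k. \<Oplus>\<^bsub>weyl I n\<^esub>i\<in>I. weyl_scale I n (v i) (H i t k))"

text \<open>
  A connection on the trivial bundle is \<open>d - \<omega>\<close> for a unique one-form \<open>\<omega>\<close>.  The difference
  of two connections is a one-form: \<open>(d - \<omega>) - (d - \<omega>') = \<omega>' - \<omega>\<close>.
\<close>

datatype 'i connection = D_minus "'i one_form"

fun connection_diff ::
    "'i set \<Rightarrow> nat \<Rightarrow> 'i connection \<Rightarrow> 'i connection \<Rightarrow> 'i one_form" where
  "connection_diff I n (D_minus \<omega>) (D_minus \<omega>') = (\<lambda>t v. series_diff I n (\<omega>' t v) (\<omega> t v))"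

definition slqc_connection :: "'i set \<Rightarrow> nat \<Rightarrow> 'i connection" where
  "slqc_connection I n = D_minus (ham_form I n (slqc_ham I n))"

definition dmt_connection :: "'i set \<Rightarrow> nat \<Rightarrow> 'i connection" where
  "dmt_connection I n = D_minus (ham_form I n (dmt_ham I n))"

definition coord_vector :: "'i \<Rightarrow> 'i \<Rightarrow> complex" where
  "coord_vector i = (\<lambda>j. if j = i then 1 else 0)"

end

theory Submission
  imports Defs "HOL-Library.Multiset"
begin

text \<open>
  Written out in coordinates, the two quartic traces are
  \<open>\<Sum>\<^sub>k\<^sub>,\<^sub>l (P\<^sub>j)\<^sub>k (Q\<^sub>j)\<^sub>l (P\<^sub>i)\<^sub>l (Q\<^sub>i)\<^sub>k\<close> and \<open>\<Sum>\<^sub>k\<^sub>,\<^sub>l (Q\<^sub>i)\<^sub>k (P\<^sub>j)\<^sub>k (Q\<^sub>j)\<^sub>l (P\<^sub>i)\<^sub>l\<close>: summand by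
  summand they contain the same four letters, in a different order. Reordering letters changes
  an element of the Weyl algebra only in lower degree, so both traces have the same degree-four
  symbol, and the two connections, whose coefficients are concentrated at \<open>\<hbar>\<^sup>4\<close>, have
  difference with vanishing symbols.

  The substance lies in the words ``the symbol'': it is read off from a lift to the
  tensor algebra, and it must not depend on the lift. Equivalently, a tensor of degree at most
  \<open>k\<close> in the ideal of the commutation relations has zero degree-\<open>k\<close> part in the symmetric
  algebra (\<open>sym_part_weyl_ideal\<close>). This instance of the Poincare-Birkhoff-Witt theorem is
  obtained from a concrete representation. Let \<open>(P\<^sub>i)\<^sub>k\<close> act on formal power series in all the
  coordinates as multiplication by the variable of the same name, and \<open>(Q\<^sub>i)\<^sub>k\<close> as
  multiplication by its variable plus \<open>\<partial>/\<partial>(P\<^sub>i)\<^sub>k\<close>. These operators satisfy the commutation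
  relations (\<open>letter_op_commutator\<close>), hence the whole ideal acts by zero
  (\<open>tensor_op_weyl_ideal\<close>). On the other hand, a word of length \<open>m\<close> applied to the series
  \<open>1\<close> gives the commutative monomial of its letters plus terms of degree less than \<open>m\<close>
  (\<open>word_op_unit\<close>), so the top-degree part of a tensor can be recovered from its action on
  \<open>1\<close> (\<open>lookup_sym_part\<close>).

  Once symbols are computed on arbitrary lifts (\<open>symbol_weyl_class\<close>), the quotient map is a ring
  homomorphism under which traces, Hamiltonians and one-forms lift to explicit tensors
  (\<open>trace_PQPQ_weyl_class\<close>, \<open>trace_QPQP_weyl_class\<close>, \<open>ham_form_weyl_class\<close>), and the reordering
  argument (\<open>sym_part_lift\<close>) is applied there.
\<close>

section \<open>The tensor algebra as a ring\<close>

lemma tensor_alg_sel [simp]: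
  "monoid.mult (tensor_alg I n) = (*)" "monoid.one (tensor_alg I n) = 1"
  "ring.zero (tensor_alg I n) = 0" "ring.add (tensor_alg I n) = (+)"
  by (simp_all add: tensor_alg_def)

lemma letters_plus [simp]: "letters (u + v) = letters u @ letters v"
  by (simp add: plus_word_def)

lemma letters_zero [simp]: "letters 0 = []"
  by (simp add: zero_word_def)

lemma carrier_tensor_alg:
  "p \<in> carrier (tensor_alg I n) \<longleftrightarrow>
    (\<forall>w\<in>Poly_Mapping.keys p. set (letters w) \<subseteq> coords I n)"
  by (simp add: tensor_alg_def)

lemma tensor_le_iff:
  "p \<in> tensor_le I n k \<longleftrightarrow>
    (\<forall>w\<in>Poly_Mapping.keys p. set (letters w) \<subseteq> coords I n \<and> length (letters w) \<le> k)"
  by (auto simp: tensor_le_def carrier_tensor_alg)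

lemma tensor_le_carrier: "p \<in> tensor_le I n k \<Longrightarrow> p \<in> carrier (tensor_alg I n)"
  by (simp add: tensor_le_def)

lemma zero_tensor_le [simp]: "0 \<in> tensor_le I n k"
  by (simp add: tensor_le_iff)

lemma single_tensor_le:
  "set (letters w) \<subseteq> coords I n \<Longrightarrow> length (letters w) \<le> k \<Longrightarrow>
    Poly_Mapping.single w c \<in> tensor_le I n k"
  by (simp add: tensor_le_iff)

lemma diff_tensor_le:
  "p \<in> tensor_le I n k \<Longrightarrow> q \<in> tensor_le I n k \<Longrightarrow> p - q \<in> tensor_le I n k"
  using keys_diff[of p q] by (auto simp: tensor_le_iff)

lemma sum_tensor_le:
  "(\<And>a. a \<in> A \<Longrightarrow> g a \<in> tensor_le I n k) \<Longrightarrow> sum g A \<in> tensor_le I n k"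
  using keys_sum[of g A] by (fastforce simp: tensor_le_iff)

lemma single_carrier:
  "set (letters w) \<subseteq> coords I n \<Longrightarrow> Poly_Mapping.single w c \<in> carrier (tensor_alg I n)"
  by (simp add: carrier_tensor_alg)

lemma add_carrier:
  "p \<in> carrier (tensor_alg I n) \<Longrightarrow> q \<in> carrier (tensor_alg I n) \<Longrightarrow>
    p + q \<in> carrier (tensor_alg I n)"
  using Poly_Mapping.keys_add[of p q] by (auto simp: carrier_tensor_alg)

lemma diff_carrier:
  "p \<in> carrier (tensor_alg I n) \<Longrightarrow> q \<in> carrier (tensor_alg I n) \<Longrightarrow>
    p - q \<in> carrier (tensor_alg I n)"
  using keys_diff[of p q] by (auto simp: carrier_tensor_alg)

lemma sum_carrier:
  "(\<And>a. a \<in> A \<Longrightarrow> g a \<in> carrier (tensor_alg I n)) \<Longrightarrow> sum g A \<in> carrier (tensor_alg I n)"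
  using keys_sum[of g A] by (fastforce simp: carrier_tensor_alg)

lemma mult_carrier:
  "p \<in> carrier (tensor_alg I n) \<Longrightarrow> q \<in> carrier (tensor_alg I n) \<Longrightarrow>
    p * q \<in> carrier (tensor_alg I n)"
  using keys_mult[of p q] by (fastforce simp: carrier_tensor_alg)

lemma ring_tensor_alg: "ring (tensor_alg I n)"
proof (intro ringI abelian_groupI monoidI)
  fix p assume "p \<in> carrier (tensor_alg I n)"
  then show "\<exists>q\<in>carrier (tensor_alg I n). q \<oplus>\<^bsub>tensor_alg I n\<^esub> p = \<zero>\<^bsub>tensor_alg I n\<^esub>"
    by (intro bexI[of _ "- p"]) (simp_all add: carrier_tensor_alg)
qed (use add_carrier mult_carrier in \<open>auto simp: algebra_simps carrier_tensor_alg[of 0] carrier_tensor_alg[of 1]\<close>)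

text \<open>
  Subtraction in a ring record is derived from its addition, and has to be identified with the
  type-class subtraction in which the commutation relations are written.
\<close>

lemma minus_tensor_alg:
  assumes "p \<in> carrier (tensor_alg I n)" "q \<in> carrier (tensor_alg I n)"
  shows "p \<ominus>\<^bsub>tensor_alg I n\<^esub> q = p - q"
proof -
  interpret ring "tensor_alg I n" by (rule ring_tensor_alg)
  have "p \<ominus>\<^bsub>tensor_alg I n\<^esub> q \<oplus>\<^bsub>tensor_alg I n\<^esub> q = p"
    using assms by (simp add: a_minus_def a_assoc l_neg r_zero del: tensor_alg_sel)
  then show ?thesis
    by (simp add: eq_diff_eq)
qed

lemma tensor_expand: "p = (\<Sum>w\<in>Poly_Mapping.keys p. Poly_Mapping.single w (Poly_Mapping.lookup p w))"
  by (rule poly_mapping_eqI)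
    (auto simp: lookup_sum lookup_single when_def in_keys_iff sum.delta)

section \<open>A representation of the Weyl algebra\<close>

text \<open>
  A power series is given by its coefficients; a monomial is the multiset of its variables.
  No convergence or finiteness has to be maintained because both operators below are
  local: each coefficient of the result involves a single coefficient of the argument.
\<close>

definition times_var :: "'x \<Rightarrow> ('x multiset \<Rightarrow> complex) \<Rightarrow> 'x multiset \<Rightarrow> complex" where
  "times_var x F = (\<lambda>M. if x \<in># M then F (M - {#x#}) else 0)"

definition deriv_var :: "'x \<Rightarrow> ('x multiset \<Rightarrow> complex) \<Rightarrow> 'x multiset \<Rightarrow> complex" where
  "deriv_var x F = (\<lambda>M. of_nat (count M x + 1) * F (add_mset x M))"

lemma times_var_commute: "times_var x (times_var y F) = times_var y (times_var x F)"
  by (auto simp: times_var_def fun_eq_iff diff_right_commute in_diff_count add_mset_commute)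

lemma deriv_var_commute: "deriv_var x (deriv_var y F) = deriv_var y (deriv_var x F)"
  by (auto simp: deriv_var_def fun_eq_iff add_mset_commute)

text \<open>
  The Leibniz rule \<open>\<partial>\<^sub>x (y F) = y \<partial>\<^sub>x F + \<delta>\<^sub>x\<^sub>y F\<close>, the only source of noncommutativity.
\<close>

lemma deriv_times_var:
  "deriv_var x (times_var y F) M = times_var y (deriv_var x F) M + (if x = y then F M else 0)"
proof (cases "y \<in># M")
  case True
  then obtain N where "M = add_mset y N"
    by (metis insert_DiffM)
  then show ?thesis
    by (auto simp: deriv_var_def times_var_def algebra_simps add_mset_commute)
next
  case False
  then show ?thesis
    by (auto simp: deriv_var_def times_var_def not_in_iff[THEN iffD1])
qed

text \<open>
  The more familiar action of \<open>Q\<close> by \<open>\<partial>/\<partial>P\<close> alone also satisfies the commutation relations, but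
  every \<open>Q\<close> kills the series \<open>1\<close> there. The additional multiplication by \<open>Q\<close> makes
  top-degree parts visible on \<open>1\<close> and leaves all commutators unchanged, since multiplications
  by variables commute and \<open>\<partial>/\<partial>P\<close> commutes with multiplication by any \<open>Q\<close>.
\<close>

fun letter_op :: "'i coord \<Rightarrow> ('i coord multiset \<Rightarrow> complex) \<Rightarrow> 'i coord multiset \<Rightarrow> complex" where
  "letter_op (Pc i k) F = times_var (Pc i k) F"
| "letter_op (Qc i k) F = (\<lambda>M. times_var (Qc i k) F M + deriv_var (Pc i k) F M)"

lemma letter_op_linear:
  "letter_op x (\<lambda>M. a * F M + b * G M) = (\<lambda>M. a * letter_op x F M + b * letter_op x G M)"
  by (cases x) (auto simp: times_var_def deriv_var_def fun_eq_iff algebra_simps)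

lemma times_var_add: "times_var x (\<lambda>M. F M + G M) = (\<lambda>M. times_var x F M + times_var x G M)"
  by (auto simp: times_var_def)

lemma deriv_var_add: "deriv_var x (\<lambda>M. F M + G M) = (\<lambda>M. deriv_var x F M + deriv_var x G M)"
  by (auto simp: deriv_var_def algebra_simps)

lemma letter_op_commutator:
  "letter_op x (letter_op y F) M - letter_op y (letter_op x F) M = coord_bracket x y * F M"
  by (cases x; cases y)
    (auto simp: times_var_add deriv_var_add deriv_times_var times_var_commute deriv_var_commute)

definition word_op ::
  "'i coord word \<Rightarrow> ('i coord multiset \<Rightarrow> complex) \<Rightarrow> 'i coord multiset \<Rightarrow> complex" where
  "word_op w F = foldr letter_op (letters w) F"

lemma word_op_plus: "word_op (u + v) F = word_op u (word_op v F)"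
  by (simp add: word_op_def)

lemma word_op_linear:
  "word_op w (\<lambda>M. a * F M + b * G M) = (\<lambda>M. a * word_op w F M + b * word_op w G M)"
proof -
  have "foldr letter_op xs (\<lambda>M. a * F M + b * G M) =
      (\<lambda>M. a * foldr letter_op xs F M + b * foldr letter_op xs G M)" for xs
    by (induction xs) (simp_all add: letter_op_linear)
  then show ?thesis by (simp add: word_op_def)
qed

definition tensor_op ::
  "'i tensor \<Rightarrow> ('i coord multiset \<Rightarrow> complex) \<Rightarrow> 'i coord multiset \<Rightarrow> complex" where
  "tensor_op p F =
    (\<lambda>M. \<Sum>w\<in>Poly_Mapping.keys p. Poly_Mapping.lookup p w * word_op w F M)"

text \<open>
  Enlarging the index set allows tensors with different supports to be compared termwise.
\<close>

lemma tensor_op_superset: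
  assumes "finite A" "Poly_Mapping.keys p \<subseteq> A"
  shows "tensor_op p F M = (\<Sum>w\<in>A. Poly_Mapping.lookup p w * word_op w F M)"
  unfolding tensor_op_def using assms
  by (intro sum.mono_neutral_left) (auto simp: in_keys_iff)

lemma tensor_op_zero [simp]: "tensor_op 0 F M = 0"
  by (simp add: tensor_op_def)

lemma tensor_op_single: "tensor_op (Poly_Mapping.single w c) F M = c * word_op w F M"
  by (subst tensor_op_superset[of "{w}"]) auto

lemma tensor_op_add: "tensor_op (p + q) F M = tensor_op p F M + tensor_op q F M"
  using Poly_Mapping.keys_add[of p q]
  by (simp add: tensor_op_superset[of "Poly_Mapping.keys p \<union> Poly_Mapping.keys q"]
      lookup_add algebra_simps sum.distrib)

lemma tensor_op_diff: "tensor_op (p - q) F M = tensor_op p F M - tensor_op q F M"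
  using tensor_op_add[of "p - q" q F M] by simp

lemma tensor_op_sum: "tensor_op (sum g A) F M = (\<Sum>a\<in>A. tensor_op (g a) F M)"
  by (induction A rule: infinite_finite_induct) (simp_all add: tensor_op_add)

lemma word_op_zero: "word_op w (\<lambda>M. 0) = (\<lambda>M. 0)"
  using word_op_linear[of w 0 "\<lambda>M. 0" 0 "\<lambda>M. 0"] by simp

lemma word_op_tensor_op:
  "word_op w (tensor_op p F) M =
    (\<Sum>v\<in>Poly_Mapping.keys p. Poly_Mapping.lookup p v * word_op (w + v) F M)"
proof -
  have "word_op w (\<lambda>M. \<Sum>v\<in>A. c v * word_op v F M) M = (\<Sum>v\<in>A. c v * word_op (w + v) F M)"
    if "finite A" for A c
    using that
  proof (induction A arbitrary: M)
    case empty
    then show ?case by (simp add: word_op_zero)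
  next
    case (insert v A)
    then show ?case
      using word_op_linear[of w "c v" "word_op v F" 1 "\<lambda>M. \<Sum>v\<in>A. c v * word_op v F M"]
      by (simp add: word_op_plus)
  qed
  then show ?thesis
    unfolding tensor_op_def by simp
qed

lemma tensor_op_mult: "tensor_op (p * q) F M = tensor_op p (tensor_op q F) M"
proof -
  let ?P = "Poly_Mapping.keys p" and ?Q = "Poly_Mapping.keys q"
  have "p * q = (\<Sum>u\<in>?P. Poly_Mapping.single u (Poly_Mapping.lookup p u)) *
      (\<Sum>v\<in>?Q. Poly_Mapping.single v (Poly_Mapping.lookup q v))"
    by (simp flip: tensor_expand)
  also have "\<dots> = (\<Sum>u\<in>?P. \<Sum>v\<in>?Q.
      Poly_Mapping.single (u + v) (Poly_Mapping.lookup p u * Poly_Mapping.lookup q v))"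
    by (simp add: sum_product mult_single)
  finally have "tensor_op (p * q) F M = (\<Sum>u\<in>?P. \<Sum>v\<in>?Q.
      Poly_Mapping.lookup p u * Poly_Mapping.lookup q v * word_op (u + v) F M)"
    by (simp add: tensor_op_sum tensor_op_single)
  then show ?thesis
    by (simp add: tensor_op_def[of p] word_op_tensor_op sum_distrib_left mult.assoc)
qed

lemma finite_coords: "finite I \<Longrightarrow> finite (coords I n)"
proof -
  assume "finite I"
  moreover have "coords I n = (\<lambda>(i, k). Qc i k) ` (I \<times> {..<n}) \<union> (\<lambda>(i, k). Pc i k) ` (I \<times> {..<n})"
    by (auto simp: coords_def)
  ultimately show ?thesis by simp
qed

lemma linear_form_expand:
  assumes "finite I" "f \<in> linear_forms I n"
  shows "f = (\<Sum>x\<in>coords I n. Poly_Mapping.single (Word [x]) (Poly_Mapping.lookup f (Word [x])))"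
proof -
  have "Poly_Mapping.keys f \<subseteq> (\<lambda>x. Word [x]) ` coords I n"
  proof
    fix w assume "w \<in> Poly_Mapping.keys f"
    then have "length (letters w) = 1" "set (letters w) \<subseteq> coords I n"
      using assms(2) by (auto simp: linear_forms_def carrier_tensor_alg)
    then show "w \<in> (\<lambda>x. Word [x]) ` coords I n"
      by (cases w) (auto simp: length_Suc_conv)
  qed
  then have "f = (\<Sum>w\<in>(\<lambda>x. Word [x]) ` coords I n. Poly_Mapping.single w (Poly_Mapping.lookup f w))"
    by (subst tensor_expand) (auto intro!: sum.mono_neutral_left simp: finite_coords assms(1) in_keys_iff)
  then show ?thesis
    by (simp add: sum.reindex inj_on_def)
qed

text \<open>
  Both sides of the relation are bilinear, which reduces it to the commutators of single letters.
\<close>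

lemma tensor_op_commutator:
  assumes I: "finite I" and f: "f \<in> linear_forms I n" and g: "g \<in> linear_forms I n"
  shows "tensor_op (f * g - g * f - const (poisson I n f g)) F M = 0"
proof -
  let ?C = "coords I n"
  let ?f = "\<lambda>x. Poly_Mapping.lookup f (Word [x])" and ?g = "\<lambda>x. Poly_Mapping.lookup g (Word [x])"
  have expand: "p * q = (\<Sum>x\<in>?C. \<Sum>y\<in>?C. Poly_Mapping.single (Word [x] + Word [y])
      (Poly_Mapping.lookup p (Word [x]) * Poly_Mapping.lookup q (Word [y])))"
    if "p \<in> linear_forms I n" "q \<in> linear_forms I n" for p q
    using arg_cong2[OF linear_form_expand[OF I that(1)] linear_form_expand[OF I that(2)], of "(*)"]
    by (simp add: sum_product mult_single)
  have "tensor_op (f * g) F M =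
      (\<Sum>x\<in>?C. \<Sum>y\<in>?C. ?f x * ?g y * letter_op x (letter_op y F) M)"
    by (simp add: expand f g tensor_op_sum tensor_op_single word_op_plus) (simp add: word_op_def)
  moreover have "tensor_op (g * f) F M =
      (\<Sum>x\<in>?C. \<Sum>y\<in>?C. ?f x * ?g y * letter_op y (letter_op x F) M)"
    by (subst sum.swap, simp add: expand f g tensor_op_sum tensor_op_single word_op_plus)
       (simp add: word_op_def mult_ac)
  moreover have "tensor_op (const (poisson I n f g)) F M =
      (\<Sum>x\<in>?C. \<Sum>y\<in>?C. ?f x * ?g y * (coord_bracket x y * F M))"
    by (simp add: tensor_op_single word_op_def poisson_def sum_distrib_right sum_distrib_left mult_ac)
  ultimately show ?thesis
    by (simp add: tensor_op_diff flip: letter_op_commutator sum_subtractf right_diff_distrib)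
qed

lemma commutators_carrier:
  "{f * g - g * f - const (poisson I n f g) | f g. f \<in> linear_forms I n \<and> g \<in> linear_forms I n}
    \<subseteq> carrier (tensor_alg I n)"
  by (auto intro!: diff_carrier mult_carrier single_carrier simp: linear_forms_def)

lemma ideal_weyl_ideal: "ideal (weyl_ideal I n) (tensor_alg I n)"
  unfolding weyl_ideal_def by (rule ring.genideal_ideal[OF ring_tensor_alg commutators_carrier])

text \<open>
  Multiplicativity of the action makes its kernel a two-sided ideal; by minimality
  it then contains the ideal generated by the commutation relations.
\<close>

lemma ideal_tensor_op_kernel:
  "ideal {p \<in> carrier (tensor_alg I n). \<forall>F M. tensor_op p F M = 0} (tensor_alg I n)"
proof -
  interpret ring "tensor_alg I n" by (rule ring_tensor_alg)
  let ?K = "{p \<in> carrier (tensor_alg I n). \<forall>F M. tensor_op p F M = 0}"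
  show ?thesis
  proof (rule idealI[OF ring_tensor_alg])
    show "subgroup ?K (add_monoid (tensor_alg I n))"
    proof (rule add.subgroupI)
      fix p assume p: "p \<in> ?K"
      have "\<ominus>\<^bsub>tensor_alg I n\<^esub> p = 0 - p"
        using p minus_tensor_alg[of 0 I n p] zero_closed by (simp add: a_minus_def)
      then show "\<ominus>\<^bsub>tensor_alg I n\<^esub> p \<in> ?K"
        using p a_inv_closed[of p] by (auto simp: tensor_op_diff simp del: diff_0)
    qed (use zero_closed in \<open>auto simp: tensor_op_add add_carrier\<close>)
  next
    fix a x assume "a \<in> ?K" "x \<in> carrier (tensor_alg I n)"
    moreover from this have "tensor_op a F = (\<lambda>M. 0)" for F
      by auto
    ultimately show "x \<otimes>\<^bsub>tensor_alg I n\<^esub> a \<in> ?K" "a \<otimes>\<^bsub>tensor_alg I n\<^esub> x \<in> ?K"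
      by (auto simp: tensor_op_mult mult_carrier tensor_op_def[of x] word_op_zero)
  qed
qed

lemma tensor_op_weyl_ideal:
  assumes "finite I" "p \<in> weyl_ideal I n"
  shows "tensor_op p F M = 0"
proof -
  have "weyl_ideal I n \<subseteq> {p \<in> carrier (tensor_alg I n). \<forall>F M. tensor_op p F M = 0}"
    unfolding weyl_ideal_def
    by (rule ring.genideal_minimal[OF ring_tensor_alg ideal_tensor_op_kernel])
      (use commutators_carrier[of I n] tensor_op_commutator[OF assms(1)] in blast)
  then show ?thesis
    using assms(2) by auto
qed

section \<open>Symbols are well defined\<close>

text \<open>
  Each letter multiplies by its variable, up to a derivative that lowers the degree.
  Hence, in degrees at least the length of the word, the image of the series \<open>1\<close> agrees with the
  product of the variables. Stating this for all such degrees, and not only for the length itself,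
  makes the induction work: a coefficient of the derivative comes from one degree higher.
\<close>

lemma word_op_unit:
  "length (letters w) \<le> size M \<Longrightarrow>
    word_op w (\<lambda>M. of_bool (M = {#})) M = of_bool (M = mset (letters w))"
proof (induction "letters w" arbitrary: w M)
  case Nil
  then show ?case by (simp add: word_op_def)
next
  case (Cons x xs)
  let ?F = "word_op (Word xs) (\<lambda>M. of_bool (M = {#}))"
  have eq: "word_op w (\<lambda>M. of_bool (M = {#})) M = letter_op x ?F M"
    using Cons(2)[symmetric] by (simp add: word_op_def)
  have IH: "?F N = of_bool (N = mset xs)" if "length xs \<le> size N" for N
    using Cons(1)[of "Word xs" N] that by simp
  have times: "times_var x ?F M = of_bool (M = mset (letters w))"
  proof (cases "x \<in># M")
    case True
    then obtain N where "M = add_mset x N"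
      by (metis insert_DiffM)
    then show ?thesis
      using Cons(2)[symmetric] Cons(3) by (simp add: times_var_def IH)
  next
    case False
    then show ?thesis
      using Cons(2)[symmetric] by (auto simp: times_var_def)
  qed
  have deriv: "deriv_var y ?F M = 0" for y
  proof -
    have "Suc (length xs) \<le> size M"
      using Cons(2)[symmetric] Cons(3) by simp
    moreover from this have "add_mset y M \<noteq> mset xs"
      by (metis Suc_n_not_le_n le_Suc_eq size_add_mset size_mset Suc_le_mono le_trans)
    ultimately show ?thesis
      by (simp add: deriv_var_def IH)
  qed
  show ?case
    using times deriv by (cases x) (simp_all add: eq)
qed

lemma lookup_exponents: "Poly_Mapping.lookup (exponents w) x = count (mset (letters w)) x"
proof -
  have "Poly_Mapping.lookup (\<Sum>x\<leftarrow>xs. Poly_Mapping.single x (1::nat)) x = count (mset xs) x" for xs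
    by (induction xs) (auto simp: lookup_add lookup_single when_def)
  then show ?thesis by (simp add: exponents_def)
qed

lemma exponents_eq_iff: "exponents u = exponents v \<longleftrightarrow> mset (letters u) = mset (letters v)"
  by (metis lookup_exponents multiset_eqI poly_mapping_eqI)

lemma sym_part_superset:
  assumes "finite A" "Poly_Mapping.keys p \<subseteq> A"
  shows "sym_part k p = (\<Sum>w\<in>A. if length (letters w) = k
    then Poly_Mapping.single (exponents w) (Poly_Mapping.lookup p w) else 0)"
  unfolding sym_part_def using assms
  by (subst sum.inter_filter[symmetric])
    (auto intro!: sum.mono_neutral_left simp: in_keys_iff)

lemma sym_part_single:
  "sym_part k (Poly_Mapping.single w c) =
    (if length (letters w) = k then Poly_Mapping.single (exponents w) c else 0)"
  by (subst sym_part_superset[of "{w}"]) auto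

lemma sym_part_zero [simp]: "sym_part k 0 = 0"
  by (simp add: sym_part_def)

lemma sym_part_add: "sym_part k (p + q) = sym_part k p + sym_part k q"
  using Poly_Mapping.keys_add[of p q]
  by (simp add: sym_part_superset[of "Poly_Mapping.keys p \<union> Poly_Mapping.keys q"]
      flip: sum.distrib) (auto intro!: sum.cong simp: lookup_add single_add)

lemma sym_part_diff: "sym_part k (p - q) = sym_part k p - sym_part k q"
  using sym_part_add[of k "p - q" q] by simp

lemma sym_part_sum: "sym_part k (sum g A) = (\<Sum>a\<in>A. sym_part k (g a))"
  by (induction A rule: infinite_finite_induct) (simp_all add: sym_part_add)

text \<open>
  In degree \<open>k\<close> the shorter words of a tensor of degree at most \<open>k\<close> do not contribute to its
  value on \<open>1\<close>, and the words of length \<open>k\<close> contribute exactly their commutative images.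
\<close>

lemma lookup_sym_part:
  assumes "p \<in> tensor_le I n k" "length (letters v) = k"
  shows "Poly_Mapping.lookup (sym_part k p) (exponents v) =
    tensor_op p (\<lambda>M. of_bool (M = {#})) (mset (letters v))"
proof -
  have "Poly_Mapping.lookup (sym_part k p) (exponents v) =
      (\<Sum>w\<in>Poly_Mapping.keys p. if length (letters w) = k \<and> mset (letters w) = mset (letters v)
        then Poly_Mapping.lookup p w else 0)"
    by (subst sym_part_superset[OF finite_keys order_refl])
      (auto simp: lookup_sum lookup_single when_def exponents_eq_iff intro!: sum.cong)
  also have "\<dots> = tensor_op p (\<lambda>M. of_bool (M = {#})) (mset (letters v))"
    unfolding tensor_op_def
  proof (rule sum.cong[OF refl])
    fix w assume "w \<in> Poly_Mapping.keys p"
    then have "length (letters w) \<le> size (mset (letters v))"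
      using assms by (auto simp: tensor_le_iff)
    moreover have "mset (letters w) = mset (letters v) \<Longrightarrow> length (letters w) = k"
      using assms(2) by (metis size_mset)
    ultimately show "(if length (letters w) = k \<and> mset (letters w) = mset (letters v)
        then Poly_Mapping.lookup p w else 0) =
      Poly_Mapping.lookup p w * word_op w (\<lambda>M. of_bool (M = {#})) (mset (letters v))"
      by (auto simp: word_op_unit)
  qed
  finally show ?thesis .
qed

text \<open>
  The part of the Poincare-Birkhoff-Witt theorem that makes symbols well defined. Monomials
  that are not of degree \<open>k\<close> do not occur in the degree-\<open>k\<close> part; the others are the
  exponents of some word of length \<open>k\<close>, where the coefficient is a value of the zero operator.
\<close>

lemma sym_part_weyl_ideal:
  assumes "finite I" "p \<in> weyl_ideal I n" "p \<in> tensor_le I n k"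
  shows "sym_part k p = 0"
proof (rule poly_mapping_eqI)
  fix e
  show "Poly_Mapping.lookup (sym_part k p) e = Poly_Mapping.lookup 0 e"
  proof (cases "\<exists>v. length (letters v) = k \<and> exponents v = e")
    case True
    then show ?thesis
      using lookup_sym_part[OF assms(3)] tensor_op_weyl_ideal[OF assms(1,2)] by auto
  next
    case False
    then show ?thesis
      by (auto simp: sym_part_def lookup_sum lookup_single when_def intro!: sum.neutral)
  qed
qed

lemma weyl_class_eqD:
  assumes "p \<in> carrier (tensor_alg I n)" "q \<in> carrier (tensor_alg I n)"
    and "weyl_class I n p = weyl_class I n q"
  shows "p - q \<in> weyl_ideal I n"
proof -
  interpret ideal "weyl_ideal I n" "tensor_alg I n" by (rule ideal_weyl_ideal)
  show ?thesis
    using assms quotient_eq_iff_same_a_r_cos[OF ideal_weyl_ideal, of p q]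
    by (simp add: weyl_class_def minus_tensor_alg)
qed

lemma symbol_weyl_class:
  assumes "finite I" "p \<in> tensor_le I n k"
  shows "symbol I n k (weyl_class I n p) = sym_part k p"
  unfolding symbol_def
proof (rule the_equality)
  show "\<exists>q\<in>tensor_le I n k. weyl_class I n p = weyl_class I n q \<and> sym_part k p = sym_part k q"
    using assms(2) by blast
next
  fix s assume "\<exists>q\<in>tensor_le I n k. weyl_class I n p = weyl_class I n q \<and> s = sym_part k q"
  then obtain q where q: "q \<in> tensor_le I n k" "weyl_class I n p = weyl_class I n q"
    "s = sym_part k q" by blast
  then have "sym_part k (p - q) = 0"
    using assms by (intro sym_part_weyl_ideal weyl_class_eqD tensor_le_carrier diff_tensor_le)
  with q(3) show "s = sym_part k p"
    by (simp add: sym_part_diff)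
qed

section \<open>Arithmetic of classes in the Weyl algebra\<close>

lemma weyl_class_ring_hom: "ring_hom_ring (tensor_alg I n) (weyl I n) (weyl_class I n)"
proof -
  have "weyl_class I n = (+>\<^bsub>tensor_alg I n\<^esub>) (weyl_ideal I n)"
    by (simp add: weyl_class_def fun_eq_iff)
  then show ?thesis
    using ideal.rcos_ring_hom_ring[OF ideal_weyl_ideal] by (simp add: weyl_def)
qed

lemma weyl_class_closed:
  "p \<in> carrier (tensor_alg I n) \<Longrightarrow> weyl_class I n p \<in> carrier (weyl I n)"
  by (rule ring_hom_closed[OF ring_hom_ring.homh[OF weyl_class_ring_hom]])

lemma weyl_class_zero: "\<zero>\<^bsub>weyl I n\<^esub> = weyl_class I n 0"
proof -
  interpret ring_hom_ring "tensor_alg I n" "weyl I n" "weyl_class I n"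
    by (rule weyl_class_ring_hom)
  show ?thesis
    using hom_zero by simp
qed

lemma weyl_class_mult:
  "p \<in> carrier (tensor_alg I n) \<Longrightarrow> q \<in> carrier (tensor_alg I n) \<Longrightarrow>
    weyl_class I n p \<otimes>\<^bsub>weyl I n\<^esub> weyl_class I n q = weyl_class I n (p * q)"
  using ring_hom_mult[OF ring_hom_ring.homh[OF weyl_class_ring_hom], of p I n q] by simp

lemma weyl_class_add:
  "p \<in> carrier (tensor_alg I n) \<Longrightarrow> q \<in> carrier (tensor_alg I n) \<Longrightarrow>
    weyl_class I n p \<oplus>\<^bsub>weyl I n\<^esub> weyl_class I n q = weyl_class I n (p + q)"
  using ring_hom_add[OF ring_hom_ring.homh[OF weyl_class_ring_hom], of p I n q] by simp

lemma weyl_class_diff: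
  assumes "p \<in> carrier (tensor_alg I n)" "q \<in> carrier (tensor_alg I n)"
  shows "weyl_class I n p \<ominus>\<^bsub>weyl I n\<^esub> weyl_class I n q = weyl_class I n (p - q)"
proof -
  interpret ring_hom_ring "tensor_alg I n" "weyl I n" "weyl_class I n"
    by (rule weyl_class_ring_hom)
  have "weyl_class I n p = weyl_class I n (p - q) \<oplus>\<^bsub>weyl I n\<^esub> weyl_class I n q"
    using assms by (simp add: weyl_class_add diff_carrier)
  then show ?thesis
    using assms diff_carrier[OF assms]
    by (simp add: a_minus_def S.a_assoc S.r_neg weyl_class_closed)
qed

lemma weyl_class_finsum:
  assumes "\<And>a. a \<in> A \<Longrightarrow> g a \<in> carrier (tensor_alg I n)"
    and "\<And>a. a \<in> A \<Longrightarrow> f a = weyl_class I n (g a)"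
  shows "(\<Oplus>\<^bsub>weyl I n\<^esub>a\<in>A. f a) = weyl_class I n (sum g A)"
proof -
  interpret ring_hom_ring "tensor_alg I n" "weyl I n" "weyl_class I n"
    by (rule weyl_class_ring_hom)
  show ?thesis
    using assms
  proof (induction A rule: infinite_finite_induct)
    case (infinite A)
    then show ?case by (simp add: S.finsum_infinite weyl_class_zero)
  next
    case empty
    then show ?case by (simp add: weyl_class_zero)
  next
    case (insert a A)
    then have "f \<in> A \<rightarrow> carrier (weyl I n)"
      by (auto simp: weyl_class_closed)
    with insert show ?case
      by (simp add: S.finsum_insert weyl_class_closed weyl_class_add sum_carrier)
  qed
qed

lemma const_carrier: "const c \<in> carrier (tensor_alg I n)"
  by (simp add: single_carrier)

lemma weyl_scale_weyl_class:
  "p \<in> carrier (tensor_alg I n) \<Longrightarrow>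
    weyl_scale I n c (weyl_class I n p) = weyl_class I n (const c * p)"
  by (simp add: weyl_scale_def weyl_class_mult const_carrier)

lemma mat_mul_weyl_class:
  assumes "\<And>k. k \<in> K \<Longrightarrow> p k \<in> carrier (tensor_alg I n)"
    and "\<And>k. k \<in> K \<Longrightarrow> q k \<in> carrier (tensor_alg I n)"
    and "\<And>k. k \<in> K \<Longrightarrow> M r k = weyl_class I n (p k)"
    and "\<And>k. k \<in> K \<Longrightarrow> N k c = weyl_class I n (q k)"
  shows "mat_mul (weyl I n) K M N r c = weyl_class I n (\<Sum>k\<in>K. p k * q k)"
  unfolding mat_mul_def
  by (rule weyl_class_finsum) (simp_all add: assms weyl_class_mult mult_carrier)

text \<open>
  The inner index runs over the one basis vector of a line \<open>V\<^sub>i\<close>, so the product is an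
  outer product of a column and a row.
\<close>

lemma mat_mul_line_weyl_class:
  assumes "p \<in> carrier (tensor_alg I n)" "q \<in> carrier (tensor_alg I n)"
    and "M r () = weyl_class I n p" "N () c = weyl_class I n q"
  shows "mat_mul (weyl I n) UNIV M N r c = weyl_class I n (p * q)"
  using mat_mul_weyl_class[of UNIV "\<lambda>_. p" I n "\<lambda>_. q" M r N c] assms
  by (simp add: UNIV_unit)

lemma mat_trace_weyl_class:
  assumes "\<And>k. k \<in> K \<Longrightarrow> p k \<in> carrier (tensor_alg I n)"
    and "\<And>k. k \<in> K \<Longrightarrow> M k k = weyl_class I n (p k)"
  shows "mat_trace (weyl I n) K M = weyl_class I n (\<Sum>k\<in>K. p k)"
  unfolding mat_trace_def by (rule weyl_class_finsum) (simp_all add: assms)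

section \<open>Lifts of the two Hamiltonians\<close>

definition lift_PQPQ :: "nat \<Rightarrow> 'i \<Rightarrow> 'i \<Rightarrow> 'i tensor" where
  "lift_PQPQ n j i =
    (\<Sum>k<n. \<Sum>l<n. Poly_Mapping.single (Word [Pc j k, Qc j l, Pc i l, Qc i k]) 1)"

definition lift_QPQP :: "nat \<Rightarrow> 'i \<Rightarrow> 'i \<Rightarrow> 'i tensor" where
  "lift_QPQP n i j =
    (\<Sum>l<n. \<Sum>k<n. Poly_Mapping.single (Word [Qc i k, Pc j k, Qc j l, Pc i l]) 1)"

lemma letter_carrier:
  assumes "i \<in> I" "k < n"
  shows "letter (Qc i k) \<in> carrier (tensor_alg I n)" "letter (Pc i k) \<in> carrier (tensor_alg I n)"
  using assms by (auto intro!: single_carrier simp: coords_def)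

lemma lift_tensor_le:
  assumes "i \<in> I" "j \<in> I"
  shows "lift_PQPQ n j i \<in> tensor_le I n 4" "lift_QPQP n i j \<in> tensor_le I n 4"
  using assms unfolding lift_PQPQ_def lift_QPQP_def
  by (auto intro!: sum_tensor_le single_tensor_le simp: coords_def)

lemma Qhat_entry: "Qhat I n i u k = weyl_class I n (letter (Qc i k))"
  and Phat_entry: "Phat I n i k u = weyl_class I n (letter (Pc i k))"
  by (simp_all add: Qhat_def Phat_def)

lemma trace_PQPQ_weyl_class:
  assumes ij: "i \<in> I" "j \<in> I"
  shows "trace_PQPQ I n j i = weyl_class I n (lift_PQPQ n j i)"
proof -
  note lc = letter_carrier[OF ij(1)] letter_carrier[OF ij(2)]
  let ?PQ = "mat_mul (weyl I n) UNIV (Phat I n j) (Qhat I n j)"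
  let ?PQP = "mat_mul (weyl I n) {..<n} ?PQ (Phat I n i)"
  let ?PQPQ = "mat_mul (weyl I n) UNIV ?PQP (Qhat I n i)"
  have PQ: "?PQ k l = weyl_class I n (letter (Pc j k) * letter (Qc j l))" if "k < n" "l < n" for k l
    by (rule mat_mul_line_weyl_class) (simp_all add: lc that Phat_entry Qhat_entry)
  have PQP: "?PQP k u =
      weyl_class I n (\<Sum>l<n. letter (Pc j k) * letter (Qc j l) * letter (Pc i l))" if "k < n" for k u
    by (rule mat_mul_weyl_class) (simp_all add: lc that PQ mult_carrier Phat_entry)
  have PQPQ: "?PQPQ k k = weyl_class I n
      ((\<Sum>l<n. letter (Pc j k) * letter (Qc j l) * letter (Pc i l)) * letter (Qc i k))"
    if "k < n" for k
    by (rule mat_mul_line_weyl_class)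
      (use that in \<open>auto simp: PQP Qhat_entry intro!: sum_carrier mult_carrier lc\<close>)
  have "trace_PQPQ I n j i = weyl_class I n (\<Sum>k<n.
      (\<Sum>l<n. letter (Pc j k) * letter (Qc j l) * letter (Pc i l)) * letter (Qc i k))"
    unfolding trace_PQPQ_def Let_def
    by (rule mat_trace_weyl_class) (auto simp: PQPQ intro!: sum_carrier mult_carrier lc)
  then show ?thesis
    by (simp add: lift_PQPQ_def sum_distrib_right mult_single plus_word_def)
qed

lemma trace_QPQP_weyl_class:
  assumes ij: "i \<in> I" "j \<in> I"
  shows "trace_QPQP I n i j = weyl_class I n (lift_QPQP n i j)"
proof -
  note lc = letter_carrier[OF ij(1)] letter_carrier[OF ij(2)]
  let ?QP = "mat_mul (weyl I n) {..<n} (Qhat I n i) (Phat I n j)"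
  let ?QPQ = "mat_mul (weyl I n) UNIV ?QP (Qhat I n j)"
  let ?QPQP = "mat_mul (weyl I n) {..<n} ?QPQ (Phat I n i)"
  have QP: "?QP u v = weyl_class I n (\<Sum>k<n. letter (Qc i k) * letter (Pc j k))" for u v
    by (rule mat_mul_weyl_class) (simp_all add: lc Phat_entry Qhat_entry)
  have QPQ: "?QPQ u l = weyl_class I n
      ((\<Sum>k<n. letter (Qc i k) * letter (Pc j k)) * letter (Qc j l))" if "l < n" for u l
    by (rule mat_mul_line_weyl_class)
      (use that in \<open>auto simp: QP Qhat_entry intro!: sum_carrier mult_carrier lc\<close>)
  have QPQP: "?QPQP u v = weyl_class I n (\<Sum>l<n.
      (\<Sum>k<n. letter (Qc i k) * letter (Pc j k)) * letter (Qc j l) * letter (Pc i l))" for u v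
    by (rule mat_mul_weyl_class) (auto simp: QPQ Phat_entry intro!: sum_carrier mult_carrier lc)
  have "trace_QPQP I n i j = weyl_class I n (\<Sum>u\<in>(UNIV :: unit set). \<Sum>l<n.
      (\<Sum>k<n. letter (Qc i k) * letter (Pc j k)) * letter (Qc j l) * letter (Pc i l))"
    unfolding trace_QPQP_def Let_def
    by (rule mat_trace_weyl_class) (auto simp: QPQP intro!: sum_carrier mult_carrier lc)
  then show ?thesis
    by (simp add: lift_QPQP_def sum_distrib_right mult_single plus_word_def UNIV_unit)
qed

lemma sym_part_reorder:
  assumes "mset (letters u) = mset (letters v)"
  shows "sym_part k (Poly_Mapping.single u c) = sym_part k (Poly_Mapping.single v c)"
proof -
  have "exponents u = exponents v"
    using assms by (simp add: exponents_eq_iff)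
  then show ?thesis
    using mset_eq_length[OF assms] by (simp add: sym_part_single)
qed

text \<open>
  The point where the two Hamiltonians agree: corresponding words are cyclic rotations of each
  other.
\<close>

lemma sym_part_lift: "sym_part k (lift_PQPQ n j i) = sym_part k (lift_QPQP n i j)"
proof -
  have "sym_part k (lift_PQPQ n j i) =
      (\<Sum>a<n. \<Sum>b<n. sym_part k (Poly_Mapping.single (Word [Pc j a, Qc j b, Pc i b, Qc i a]) 1))"
    by (simp add: lift_PQPQ_def sym_part_sum)
  also have "\<dots> =
      (\<Sum>a<n. \<Sum>b<n. sym_part k (Poly_Mapping.single (Word [Qc i a, Pc j a, Qc j b, Pc i b]) 1))"
    by (intro sum.cong refl sym_part_reorder) (simp add: add_mset_commute)
  also have "\<dots> = sym_part k (lift_QPQP n i j)"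
    by (subst sum.swap) (simp add: lift_QPQP_def sym_part_sum)
  finally show ?thesis .
qed

lemma const_mult_expand:
  "const c * p = (\<Sum>w\<in>Poly_Mapping.keys p. Poly_Mapping.single w (c * Poly_Mapping.lookup p w))"
proof -
  have "const c * p = const c *
      (\<Sum>w\<in>Poly_Mapping.keys p. Poly_Mapping.single w (Poly_Mapping.lookup p w))"
    by (simp flip: tensor_expand)
  then show ?thesis
    by (simp add: sum_distrib_left mult_single)
qed

lemma const_mult_tensor_le: "p \<in> tensor_le I n k \<Longrightarrow> const c * p \<in> tensor_le I n k"
  unfolding const_mult_expand
  by (intro sum_tensor_le single_tensor_le) (auto simp: tensor_le_iff)

lemma sym_part_const_mult:
  "sym_part k (const c * p) = Poly_Mapping.single 0 c * sym_part k p"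
proof -
  have "sym_part k (const c * p) = (\<Sum>w\<in>Poly_Mapping.keys p. if length (letters w) = k
      then Poly_Mapping.single (exponents w) (c * Poly_Mapping.lookup p w) else 0)"
    by (simp add: const_mult_expand sym_part_sum sym_part_single)
  also have "\<dots> = Poly_Mapping.single 0 c * sym_part k p"
    by (subst sym_part_superset[OF finite_keys order_refl])
      (auto simp: sum_distrib_left mult_single intro!: sum.cong)
  finally show ?thesis .
qed

text \<open>
  A tensor lift of the coefficient of \<open>\<hbar>\<^sup>k\<close> in a Hamiltonian with quartic terms \<open>T i j\<close>.
\<close>

definition lift_ham ::
  "'i set \<Rightarrow> ('i \<Rightarrow> 'i \<Rightarrow> 'i tensor) \<Rightarrow> ('i \<Rightarrow> complex) \<Rightarrow> 'i \<Rightarrow> nat \<Rightarrow> 'i tensor" where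
  "lift_ham I T t i k = (if k = 4 then \<Sum>j\<in>I - {i}. const (1 / (t i - t j)) * T i j else 0)"

lemma lift_ham_tensor_le:
  "i \<in> I \<Longrightarrow> (\<And>j. j \<in> I \<Longrightarrow> T i j \<in> tensor_le I n 4) \<Longrightarrow> lift_ham I T t i k \<in> tensor_le I n k"
  by (auto simp: lift_ham_def intro!: sum_tensor_le const_mult_tensor_le)

lemma hbar_monom_weyl_class:
  assumes "i \<in> I" and T: "\<And>j. j \<in> I \<Longrightarrow> T i j \<in> tensor_le I n 4"
    and tr: "\<And>j. j \<in> I \<Longrightarrow> tr j = weyl_class I n (T i j)"
  shows "hbar_monom I n (\<Oplus>\<^bsub>weyl I n\<^esub>j\<in>I - {i}. weyl_scale I n (1 / (t i - t j)) (tr j)) 4 k =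
    weyl_class I n (lift_ham I T t i k)"
proof -
  have "(\<Oplus>\<^bsub>weyl I n\<^esub>j\<in>I - {i}. weyl_scale I n (1 / (t i - t j)) (tr j)) =
      weyl_class I n (\<Sum>j\<in>I - {i}. const (1 / (t i - t j)) * T i j)"
    by (rule weyl_class_finsum)
      (use tensor_le_carrier[OF T] in \<open>auto simp: tr weyl_scale_weyl_class mult_carrier const_carrier\<close>)
  then show ?thesis
    by (simp add: hbar_monom_def lift_ham_def weyl_class_zero)
qed

lemma ham_form_weyl_class:
  assumes "\<And>i. i \<in> I \<Longrightarrow> H i t k = weyl_class I n (h i)"
    and "\<And>i. i \<in> I \<Longrightarrow> h i \<in> carrier (tensor_alg I n)"
  shows "ham_form I n H t v k = weyl_class I n (\<Sum>i\<in>I. const (v i) * h i)"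
  unfolding ham_form_def
  by (rule weyl_class_finsum) (simp_all add: assms weyl_scale_weyl_class mult_carrier const_carrier)

section \<open>Vanishing in the semiclassical limit\<close>

lemma weyl_order_zero: "weyl_order I n (weyl_class I n 0) = 0"
  by (simp add: weyl_order_def weyl_le_def Least_eq_0)

text \<open>
  A series with polynomial dependence on \<open>\<hbar>\<close> satisfies the growth condition because its later
  coefficients vanish and the zero element has order \<open>0\<close>, so that the difference in question is
  eventually \<open>k\<close> itself.
\<close>

lemma semiclassical_kernelI:
  assumes "finite I" and le: "\<And>k. p k \<in> tensor_le I n k"
    and sym: "\<And>k. sym_part k (p k) = 0"
    and fin: "finite {k. p k \<noteq> 0}"
  shows "(\<lambda>k. weyl_class I n (p k)) \<in> semiclassical_kernel I n"
proof -
  have "eventually (\<lambda>k. p k = 0) sequentially"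
    using fin by (simp add: eventually_cofinite flip: cofinite_eq_sequentially)
  then have "eventually (\<lambda>k. int k = int k - int (weyl_order I n (weyl_class I n (p k)))) sequentially"
    by eventually_elim (simp add: weyl_order_zero)
  then have "filterlim (\<lambda>k. int k - int (weyl_order I n (weyl_class I n (p k)))) at_top sequentially"
    using filterlim_int_sequentially by (rule filterlim_cong[OF refl refl, THEN iffD1])
  then show ?thesis
    using le by (auto simp: semiclassical_kernel_def weyl_hat_def weyl_le_def semiclassical_def
        symbol_weyl_class[OF assms(1) le] sym)
qed

text \<open>
  The equality of symbols holds separately for every pair of nodes, whatever the scalar
  coefficients are, so it survives the summation over the nodes with weights \<open>1/(t\<^sub>i - t\<^sub>j)\<close> and
  the evaluation of the one-form on a tangent vector.
\<close>

theorem theorem8p3: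
  fixes I :: "'i set" and n :: nat
  assumes "finite I"
  shows "\<forall>t \<in> base_space I. \<forall>i \<in> I.
    connection_diff I n (slqc_connection I n) (dmt_connection I n) t (coord_vector i)
      \<in> semiclassical_kernel I n"
proof (intro ballI)
  fix t :: "'i \<Rightarrow> complex" and i0 :: 'i
  let ?v = "coord_vector i0"
  define X where "X = lift_ham I (\<lambda>i j. lift_PQPQ n j i) t"
  define Y where "Y = lift_ham I (lift_QPQP n) t"
  \<comment> \<open>The connections are \<open>d - \<omega>\<close> and \<open>d - \<omega>'\<close>, so their difference is \<open>\<omega>' - \<omega>\<close>.\<close>
  define D where "D k = (\<Sum>i\<in>I. const (?v i) * (Y i k - X i k))" for k
  have le: "X i k \<in> tensor_le I n k" "Y i k \<in> tensor_le I n k" if "i \<in> I" for i k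
    using that unfolding X_def Y_def by (auto intro!: lift_ham_tensor_le lift_tensor_le)
  note car = le[THEN tensor_le_carrier]
  have "ham_form I n (slqc_ham I n) t ?v k = weyl_class I n (\<Sum>i\<in>I. const (?v i) * X i k)"
    and "ham_form I n (dmt_ham I n) t ?v k = weyl_class I n (\<Sum>i\<in>I. const (?v i) * Y i k)" for k
    unfolding X_def Y_def slqc_ham_def dmt_ham_def
    by (rule ham_form_weyl_class, rule hbar_monom_weyl_class,
        simp_all add: lift_tensor_le trace_PQPQ_weyl_class trace_QPQP_weyl_class
          lift_ham_tensor_le[THEN tensor_le_carrier])+
  then have "connection_diff I n (slqc_connection I n) (dmt_connection I n) t ?v =
      (\<lambda>k. weyl_class I n (D k))"
    by (simp add: slqc_connection_def dmt_connection_def series_diff_def fun_eq_iff D_def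
        weyl_class_diff sum_carrier mult_carrier const_carrier car right_diff_distrib
        flip: sum_subtractf)
  moreover have "(\<lambda>k. weyl_class I n (D k)) \<in> semiclassical_kernel I n"
  proof (rule semiclassical_kernelI[OF assms])
    show "D k \<in> tensor_le I n k" for k
      unfolding D_def by (intro sum_tensor_le const_mult_tensor_le diff_tensor_le le)
    have "sym_part k (Y i k) = sym_part k (X i k)" for i k
      by (simp add: X_def Y_def lift_ham_def sym_part_sum sym_part_const_mult sym_part_lift)
    then show "sym_part k (D k) = 0" for k
      by (simp add: D_def sym_part_sum sym_part_const_mult sym_part_diff)
    have "D k = 0" if "k \<noteq> 4" for k
      using that by (simp add: D_def X_def Y_def lift_ham_def)
    then have "{k. D k \<noteq> 0} \<subseteq> {4}"
      by auto
    then show "finite {k. D k \<noteq> 0}"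
      by (rule finite_subset) simp
  qed
  ultimately show "connection_diff I n (slqc_connection I n) (dmt_connection I n) t ?v
      \<in> semiclassical_kernel I n"
    by simp
qed

end
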